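(* For $n\ge1$, the number $c(n)$ of connected solutions $(X,Y)\in T_n^2$ of the system $X^2=X$, $Y^2=Y$, $XY=YX$ is $$c(n)=\sum_{0\le r,s,t\le n}\frac{n!}{r!\,s!\,t!\,(n-r-s-t)!}\,r^{n-r-s-t}s^{n-r-s+1},$$ where $0^0=1$ and $1/m!=0$ for negative integers $m$ (so the sum is restricted to $r+s+t\le n$).
   Context: $T_n$ is the semigroup of all maps $[n]\to[n]$, $[n]=\{1,\dots,n\}$, with product $(\tau_1\cdot\tau_2)(j)=\tau_2(\tau_1(j))$. A pair $(X,Y)\in T_n^2$ is connected if the directed graph on $[n]$ with edges $j\to X(j)$ and $j\to Y(j)$ (for all $j$) is connected when edge directions are ignored. *)

theory Defs
  imports
    Complex_Main
    "HOL-Library.FuncSet"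
    "Graph_Theory.Digraph_Component"
begin

definition full_transf :: "nat \<Rightarrow> (nat \<Rightarrow> nat) set" where
  "full_transf n = {1..n} \<rightarrow>\<^sub>E {1..n}"

text \<open>Products are read from left to right: the left factor is applied first.\<close>

definition transf_mult :: "nat \<Rightarrow> (nat \<Rightarrow> nat) \<Rightarrow> (nat \<Rightarrow> nat) \<Rightarrow> (nat \<Rightarrow> nat)" where
  "transf_mult n \<tau>\<^sub>1 \<tau>\<^sub>2 = (\<lambda>j\<in>{1..n}. \<tau>\<^sub>2 (\<tau>\<^sub>1 j))"

definition transf_digraph :: "nat \<Rightarrow> (nat \<Rightarrow> nat) \<Rightarrow> (nat \<Rightarrow> nat) \<Rightarrow> nat pair_pre_digraph" where
  "transf_digraph n X Y =
     \<lparr> pverts = {1..n}, parcs = (\<lambda>j. (j, X j)) ` {1..n} \<union> (\<lambda>j. (j, Y j)) ` {1..n} \<rparr>"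

text \<open>The qualified constant is weak connectedness of digraphs (connectedness of the
  symmetrization); the unqualified name could also denote topological connectedness.\<close>

definition connected_pair :: "nat \<Rightarrow> (nat \<Rightarrow> nat) \<Rightarrow> (nat \<Rightarrow> nat) \<Rightarrow> bool" where
  "connected_pair n X Y \<longleftrightarrow> Digraph_Component.connected (with_proj (transf_digraph n X Y))"

definition connected_solutions :: "nat \<Rightarrow> ((nat \<Rightarrow> nat) \<times> (nat \<Rightarrow> nat)) set" where
  "connected_solutions n =
     {(X, Y). X \<in> full_transf n \<and> Y \<in> full_transf n \<and>
        transf_mult n X X = X \<and> transf_mult n Y Y = Y \<and>
        transf_mult n X Y = transf_mult n Y X \<and>
        connected_pair n X Y}"

end

theory Submission
  imports Defs
begin

text \<open>
  If \<open>X\<close> and \<open>Y\<close> are commuting idempotents, then \<open>XY\<close> is constant along the edges of the graph and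
  every \<open>j\<close> is joined to \<open>XY(j)\<close>; hence the pair is connected iff \<open>XY\<close> is constant, with value the
  unique common fixed point \<open>z\<close>. Let \<open>S\<close> be the fixed points of \<open>Y\<close> and \<open>A \<union> {z}\<close> those of \<open>X\<close>, so
  \<open>z \<in> S\<close> and \<open>A \<inter> S = {}\<close>. Then \<open>X\<close> maps \<open>S\<close> to \<open>z\<close>, \<open>Y\<close> maps \<open>A\<close> to \<open>z\<close>, and on the remaining
  \<open>m = n - r - s\<close> points, where \<open>r = |A|\<close> and \<open>s = |S|\<close>, \<open>X\<close> and \<open>Y\<close> are arbitrary maps to
  \<open>A \<union> {z}\<close> and \<open>S\<close>. This gives \<open>s (r + 1)\<^sup>m s\<^sup>m\<close> pairs for each choice of \<open>S\<close> and \<open>A\<close>, and the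
  variable \<open>t\<close> comes from expanding \<open>(r + 1)\<^sup>m\<close> by the binomial theorem.
\<close>

section \<open>Connectedness of a pair of commuting idempotents\<close>

lemma connected_pair_iff_const:
  assumes X: "X \<in> {1..n} \<rightarrow> {1..n}" and Y: "Y \<in> {1..n} \<rightarrow> {1..n}"
    and XX: "\<And>j. j \<in> {1..n} \<Longrightarrow> X (X j) = X j"
    and YY: "\<And>j. j \<in> {1..n} \<Longrightarrow> Y (Y j) = Y j"
    and XY: "\<And>j. j \<in> {1..n} \<Longrightarrow> Y (X j) = X (Y j)"
  shows "connected_pair n X Y \<longleftrightarrow> (\<exists>z\<in>{1..n}. \<forall>j\<in>{1..n}. Y (X j) = z)"
proof
  let ?N = "{1..n}" and ?G = "mk_symmetric (with_proj (transf_digraph n X Y))"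
  have arcs: "arcs_ends ?G =
      (\<Union>j\<in>?N. {(j, X j), (X j, j), (j, Y j), (Y j, j)})"
    by (auto simp: parcs_mk_symmetric transf_digraph_def arcs_ends_conv)
  have verts: "verts ?G = ?N"
    by (simp add: transf_digraph_def)
  note conn = connected_pair_def Digraph_Component.connected_def strongly_connected_def
    reachable_def
  {
    assume c: "connected_pair n X Y"
    have const: "Y (X v) = Y (X u)" if "(u, v) \<in> rtrancl_on ?N (arcs_ends ?G)" for u v
      using that
    proof induct
      case (step y z)
      then obtain j where j: "j \<in> ?N" "(y, z) \<in> {(j, X j), (X j, j), (j, Y j), (Y j, j)}"
        unfolding arcs by blast
      have "Y j \<in> ?N" using Y j by blast
      \<comment> \<open>For the second identity, commutation at \<open>Y j\<close> gives
        \<open>Y (X (Y j)) = X (Y (Y j))\<close>, which collapses to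
        \<open>X (Y j) = Y (X j)\<close>.\<close>
      have "Y (X (X j)) = Y (X j)" "Y (X (Y j)) = Y (X j)"
        using XX[OF j(1)] XY[OF j(1)] XY[OF \<open>Y j \<in> ?N\<close>] YY[OF j(1)] by simp_all
      then show ?case using j step by auto
    qed simp
    \<comment> \<open>The base point exists because strong connectedness includes nonemptiness of
      the vertex set.\<close>
    from c obtain u where u: "u \<in> ?N"
      unfolding conn verts by blast
    have "\<forall>j\<in>?N. Y (X j) = Y (X u)"
      using c u const unfolding conn verts by blast
    moreover have "Y (X u) \<in> ?N" using u X Y by blast
    ultimately show "\<exists>z\<in>?N. \<forall>j\<in>?N. Y (X j) = z" by blast
  next
    assume "\<exists>z\<in>?N. \<forall>j\<in>?N. Y (X j) = z"
    then obtain z where z: "z \<in> ?N" "\<And>j. j \<in> ?N \<Longrightarrow> Y (X j) = z" by blast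
    \<comment> \<open>The path is \<open>j\<close>, \<open>X j\<close>, \<open>Y (X j) = z\<close>.
      Since reachability in the symmetrized graph is symmetric, any two vertices are then joined
      through \<open>z\<close>.\<close>
    have to_z: "(j, z) \<in> rtrancl_on ?N (arcs_ends ?G)" if j: "j \<in> ?N" for j
    proof -
      have Xj: "X j \<in> ?N" using j X by blast
      have "(j, X j) \<in> arcs_ends ?G" "(X j, z) \<in> arcs_ends ?G"
        unfolding arcs using z(2)[OF j] j Xj by auto
      then show ?thesis
        using j Xj z(1) by (meson converse_rtrancl_on_into_rtrancl_on rtrancl_on_refl)
    qed
    have "sym (rtrancl_on ?N (arcs_ends ?G))"
      unfolding arcs by (rule rtrancl_on_sym) (auto simp: sym_def)
    then have "(u, v) \<in> rtrancl_on ?N (arcs_ends ?G)" if "u \<in> ?N" "v \<in> ?N" for u v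
      using to_z[OF that(1)] to_z[OF that(2)] by (meson rtrancl_on_trans symD)
    then show "connected_pair n X Y"
      unfolding conn verts using z(1) by blast
  }
qed

text \<open>Both maps are \<open>undefined\<close> outside \<open>{1..n}\<close>, so only values on
  \<open>{1..n}\<close> need comparing.\<close>

lemma transf_mult_eq_iff:
  assumes "Z \<in> extensional {1..n}"
  shows "transf_mult n X Y = Z \<longleftrightarrow> (\<forall>j\<in>{1..n}. Y (X j) = Z j)"
  using assms by (auto simp: transf_mult_def fun_eq_iff extensional_def)

text \<open>Commutation and connectedness merge into a single pointwise condition: both composites
  are constant with the same value.\<close>

lemma mem_connected_solutions_iff:
  "(X, Y) \<in> connected_solutions n \<longleftrightarrow>
     X \<in> {1..n} \<rightarrow>\<^sub>E {1..n} \<and> Y \<in> {1..n} \<rightarrow>\<^sub>E {1..n} \<and>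
     (\<forall>j\<in>{1..n}. X (X j) = X j) \<and> (\<forall>j\<in>{1..n}. Y (Y j) = Y j) \<and>
     (\<exists>z\<in>{1..n}. \<forall>j\<in>{1..n}. Y (X j) = z \<and> X (Y j) = z)"
proof (cases "X \<in> {1..n} \<rightarrow>\<^sub>E {1..n} \<and> Y \<in> {1..n} \<rightarrow>\<^sub>E {1..n} \<and>
     (\<forall>j\<in>{1..n}. X (X j) = X j) \<and> (\<forall>j\<in>{1..n}. Y (Y j) = Y j)")
  case True
  then have ext: "X \<in> extensional {1..n}" "Y \<in> extensional {1..n}"
    and pi: "X \<in> {1..n} \<rightarrow> {1..n}" "Y \<in> {1..n} \<rightarrow> {1..n}"
    by (auto simp: PiE_def)
  have "transf_mult n X Y = transf_mult n Y X \<longleftrightarrow> (\<forall>j\<in>{1..n}. Y (X j) = X (Y j))"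
    by (subst transf_mult_eq_iff) (auto simp: transf_mult_def)
  moreover have "connected_pair n X Y \<longleftrightarrow> (\<exists>z\<in>{1..n}. \<forall>j\<in>{1..n}. Y (X j) = z)"
    if "\<forall>j\<in>{1..n}. Y (X j) = X (Y j)"
    using that True by (intro connected_pair_iff_const[OF pi]) auto
  moreover have "transf_mult n X X = X" "transf_mult n Y Y = Y"
    using True transf_mult_eq_iff[OF ext(1), of X X] transf_mult_eq_iff[OF ext(2), of Y Y] by blast+
  ultimately have "(X, Y) \<in> connected_solutions n \<longleftrightarrow> (\<forall>j\<in>{1..n}. Y (X j) = X (Y j)) \<and>
      (\<exists>z\<in>{1..n}. \<forall>j\<in>{1..n}. Y (X j) = z)"
    using True unfolding connected_solutions_def full_transf_def by blast
  also have "\<dots> \<longleftrightarrow> (\<exists>z\<in>{1..n}. \<forall>j\<in>{1..n}. Y (X j) = z \<and> X (Y j) = z)"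
    by metis
  finally show ?thesis
    using True by blast
next
  case False
  then have "(X, Y) \<notin> connected_solutions n"
    using transf_mult_eq_iff[of X n X X] transf_mult_eq_iff[of Y n Y Y]
    unfolding connected_solutions_def full_transf_def PiE_def by blast
  then show ?thesis
    using False by blast
qed

section \<open>Partition of the solutions by fixed-point sets\<close>

text \<open>Each point gets its own set of allowed values under \<open>X\<close> and under
  \<open>Y\<close>, chosen independently, so the cardinality of a block is a product over
  points.\<close>

definition solution_block :: "nat \<Rightarrow> nat set \<times> nat set \<times> nat \<Rightarrow> ((nat \<Rightarrow> nat) \<times> (nat \<Rightarrow> nat)) set" where
  "solution_block n = (\<lambda>(S, A, z).
     (\<Pi>\<^sub>E j\<in>{1..n}. if j \<in> insert z A then {j} else if j \<in> S then {z} else insert z A) \<times>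
     (\<Pi>\<^sub>E j\<in>{1..n}. if j \<in> S then {j} else if j \<in> A then {z} else S))"

text \<open>The choice of \<open>z\<close> in \<open>S\<close> will supply one extra factor
  \<open>s\<close>. As \<open>A\<close> avoids \<open>S\<close>, it also avoids
  \<open>z\<close>.\<close>

definition block_index :: "nat \<Rightarrow> (nat set \<times> nat set \<times> nat) set" where
  "block_index n = (SIGMA S:Pow {1..n}. Pow ({1..n} - S) \<times> S)"

text \<open>\<open>X\<close> takes values in \<open>insert z A\<close>, which it fixes and
  \<open>Y\<close> sends to \<open>z\<close>; \<open>Y\<close> takes values in \<open>S\<close>,
  which it fixes and \<open>X\<close> sends to \<open>z\<close>. The first two claims recover the
  index from the pair and later separate the blocks.\<close>

lemma mem_solution_blockD:
  assumes idx: "(S, A, z) \<in> block_index n" and mem: "(X, Y) \<in> solution_block n (S, A, z)"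
  shows "S = {j \<in> {1..n}. Y j = j}" "insert z A = {j \<in> {1..n}. X j = j}"
    "(X, Y) \<in> connected_solutions n"
proof -
  have S: "S \<subseteq> {1..n}" "A \<subseteq> {1..n}" "A \<inter> S = {}" "z \<in> S"
    using idx by (auto simp: block_index_def)
  have X: "X j \<in> (if j \<in> insert z A then {j} else if j \<in> S then {z} else insert z A)"
    and Y: "Y j \<in> (if j \<in> S then {j} else if j \<in> A then {z} else S)" if "j \<in> {1..n}" for j
    using mem that PiE_mem unfolding solution_block_def by fast+
  have ext: "X \<in> extensional {1..n}" "Y \<in> extensional {1..n}"
    using mem by (auto simp: solution_block_def PiE_def)
  have zN: "z \<in> {1..n}" using S by blast
  have Xfix: "X j = j" if "j \<in> insert z A" for j
    using X[of j] that S zN by auto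
  have Yfix: "Y j = j" if "j \<in> S" for j
    using Y[of j] that S by auto
  have Xmem: "X j \<in> insert z A" if "j \<in> {1..n}" for j
    using X[OF that] by (auto split: if_splits)
  have Ymem: "Y j \<in> S" if "j \<in> {1..n}" for j
    using Y[OF that] S by (auto split: if_splits)
  \<comment> \<open>At \<open>j = z\<close>, which also lies in \<open>S\<close>, the first branch
    applies, and its only value is again \<open>z\<close>.\<close>
  have XS: "X j = z" if "j \<in> S" for j
  proof -
    have "j \<in> {1..n}" "j \<notin> A" using that S by blast+
    then show ?thesis using X[of j] that by (simp split: if_splits)
  qed
  have YA: "Y j = z" if "j \<in> insert z A" for j
  proof (cases "j = z")
    case False
    then have "j \<in> {1..n}" "j \<in> A" "j \<notin> S" using that S by blast+
    then show ?thesis using Y[of j] by simp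
  qed (simp add: Yfix S)
  show "S = {j \<in> {1..n}. Y j = j}"
    using Yfix Ymem S(1) by fastforce
  show "insert z A = {j \<in> {1..n}. X j = j}"
    using Xfix Xmem S(2) zN by fastforce
  have "insert z A \<subseteq> {1..n}" using S zN by blast
  then have "X \<in> {1..n} \<rightarrow>\<^sub>E {1..n}" "Y \<in> {1..n} \<rightarrow>\<^sub>E {1..n}"
    using Xmem Ymem ext S(1) unfolding PiE_def by blast+
  then show "(X, Y) \<in> connected_solutions n"
    unfolding mem_connected_solutions_iff
    using Xfix[OF Xmem] Yfix[OF Ymem] XS[OF Ymem] YA[OF Xmem]
    by (intro conjI ballI bexI[OF _ zN])
qed

lemma connected_solutions_subset_blocks:
  assumes "(X, Y) \<in> connected_solutions n"
  shows "\<exists>i\<in>block_index n. (X, Y) \<in> solution_block n i"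
proof -
  let ?N = "{1..n}"
  from assms obtain z where X: "X \<in> ?N \<rightarrow>\<^sub>E ?N" and Y: "Y \<in> ?N \<rightarrow>\<^sub>E ?N"
    and XX: "\<And>j. j \<in> ?N \<Longrightarrow> X (X j) = X j" and YY: "\<And>j. j \<in> ?N \<Longrightarrow> Y (Y j) = Y j"
    and z: "z \<in> ?N" and YX: "\<And>j. j \<in> ?N \<Longrightarrow> Y (X j) = z" and XY: "\<And>j. j \<in> ?N \<Longrightarrow> X (Y j) = z"
    unfolding mem_connected_solutions_iff by blast
  have XN: "X j \<in> ?N" and YN: "Y j \<in> ?N" if "j \<in> ?N" for j
    using X Y that by blast+
  \<comment> \<open>The constant value is itself in the image of \<open>X\<close>:
    \<open>X z = X (X (Y z)) = X (Y z) = z\<close>; likewise for \<open>Y\<close>.\<close>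
  have Xz: "X z = z" using XX[OF YN[OF z]] XY[OF z] by simp
  have Yz: "Y z = z" using YY[OF XN[OF z]] YX[OF z] by simp
  define S where "S = {j \<in> ?N. Y j = j}"
  define A where "A = {j \<in> ?N. X j = j} - {z}"
  have insA: "insert z A = {j \<in> ?N. X j = j}"
    using z Xz by (auto simp: A_def)
  have XS: "X j = z" if "j \<in> S" for j
    using that XY[of j] by (auto simp: S_def)
  have YA: "Y j = z" if "j \<in> A" for j
    using that YX[of j] by (auto simp: A_def)
  \<comment> \<open>A point of both sets would satisfy \<open>j = X j = z\<close>, but
    \<open>z\<close> was removed from \<open>A\<close>.\<close>
  have "A \<inter> S = {}"
    using XS by (auto simp: A_def)
  then have "(S, A, z) \<in> block_index n"
    using z Yz by (auto simp: block_index_def S_def A_def)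
  moreover have "X \<in> (\<Pi>\<^sub>E j\<in>?N. if j \<in> insert z A then {j} else if j \<in> S then {z} else insert z A)"
  proof (rule PiE_I)
    fix j assume j: "j \<in> ?N"
    have "j \<in> insert z A \<Longrightarrow> X j = j" "X j \<in> insert z A"
      using j XN[OF j] XX[OF j] unfolding insA by blast+
    then show "X j \<in> (if j \<in> insert z A then {j} else if j \<in> S then {z} else insert z A)"
      using XS[of j] by (simp split: if_split)
  qed (use X in \<open>rule PiE_arb\<close>)
  moreover have "Y \<in> (\<Pi>\<^sub>E j\<in>?N. if j \<in> S then {j} else if j \<in> A then {z} else S)"
  proof (rule PiE_I)
    fix j assume j: "j \<in> ?N"
    have "j \<in> S \<Longrightarrow> Y j = j" "Y j \<in> S"
      using j YN[OF j] YY[OF j] unfolding S_def by blast+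
    then show "Y j \<in> (if j \<in> S then {j} else if j \<in> A then {z} else S)"
      using YA[of j] by (simp split: if_split)
  qed (use Y in \<open>rule PiE_arb\<close>)
  ultimately show ?thesis
    unfolding solution_block_def by blast
qed

lemma connected_solutions_eq_UN_blocks:
  "connected_solutions n = (\<Union>i\<in>block_index n. solution_block n i)"
proof (rule set_eqI)
  fix p :: "(nat \<Rightarrow> nat) \<times> (nat \<Rightarrow> nat)"
  obtain X Y where p: "p = (X, Y)" by fastforce
  have "(X, Y) \<in> connected_solutions n"
    if "i \<in> block_index n" "(X, Y) \<in> solution_block n i" for i
    using that mem_solution_blockD(3) by (cases i) blast
  then show "p \<in> connected_solutions n \<longleftrightarrow> p \<in> (\<Union>i\<in>block_index n. solution_block n i)"
    unfolding p using connected_solutions_subset_blocks by blast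
qed

text \<open>A pair determines \<open>S\<close> and \<open>insert z A\<close> as its fixed-point
  sets; their intersection is \<open>{z}\<close> and their difference is \<open>A\<close>.\<close>

lemma solution_blocks_disjoint:
  assumes "i \<in> block_index n" "i' \<in> block_index n" "i \<noteq> i'"
  shows "solution_block n i \<inter> solution_block n i' = {}"
proof (rule ccontr)
  assume "solution_block n i \<inter> solution_block n i' \<noteq> {}"
  then obtain X Y where XY: "(X, Y) \<in> solution_block n i" "(X, Y) \<in> solution_block n i'"
    by fastforce
  obtain S A z S' A' z' where i: "i = (S, A, z)" "i' = (S', A', z')"
    by (metis prod_cases3)
  note D = mem_solution_blockD(1,2)[OF assms(1)[unfolded i] XY(1)[unfolded i]]
    and D' = mem_solution_blockD(1,2)[OF assms(2)[unfolded i] XY(2)[unfolded i]]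
  have "S = S'" "insert z A = insert z' A'"
    using D(1) D'(1) D(2) D'(2) by (simp_all only:)
  moreover have "A = insert z A - S" "A' = insert z' A' - S'"
      "{z} = insert z A \<inter> S" "{z'} = insert z' A' \<inter> S'"
    using assms(1,2) by (auto simp: i block_index_def)
  ultimately have "A = A'" "{z} = {z'}" by metis+
  with \<open>S = S'\<close> show False using assms(3) i by simp
qed

section \<open>Counting the solutions\<close>

lemma card_solution_block:
  assumes "(S, A, z) \<in> block_index n"
  shows "card (solution_block n (S, A, z)) =
    (card A + 1) ^ (n - card S - card A) * card S ^ (n - card S - card A)"
proof -
  have S: "S \<subseteq> {1..n}" "A \<subseteq> {1..n}" "A \<inter> S = {}" "z \<in> S"
    using assms by (auto simp: block_index_def)
  have fin: "finite S" "finite A"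
    using S finite_subset by blast+
  define C where "C = {1..n} - S - A"
  have cardC: "card C = n - card S - card A"
    using S fin by (simp add: C_def card_Diff_subset disjoint_iff Diff_eq_empty_iff subset_iff)
  have z: "z \<notin> A" using S by blast
  \<comment> \<open>Points of \<open>S\<close> and \<open>A\<close> have a single allowed value
    under each map, so only the points of \<open>C\<close> contribute to the products.\<close>
  have prodC: "(\<Prod>j\<in>{1..n}. f j) = (\<Prod>j\<in>C. f j)" if "\<And>j. j \<in> S \<union> A \<Longrightarrow> f j = (1::nat)" for f
    using that by (intro prod.mono_neutral_right) (auto simp: C_def)
  have "card (\<Pi>\<^sub>E j\<in>{1..n}. if j \<in> insert z A then {j} else if j \<in> S then {z} else insert z A)
      = (\<Prod>j\<in>C. card (if j \<in> insert z A then {j} else if j \<in> S then {z} else insert z A))"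
    by (subst card_PiE, simp, rule prodC) auto
  \<comment> \<open>\<open>z\<close> lies in \<open>S\<close>, so no point of \<open>C\<close> is in
    \<open>insert z A\<close>; and \<open>z\<close> is not in \<open>A\<close>, whence the summand
    1.\<close>
  also have "\<dots> = (\<Prod>j\<in>C. card A + 1)"
    by (rule prod.cong) (use S fin z in \<open>auto simp: C_def\<close>)
  finally have "card (\<Pi>\<^sub>E j\<in>{1..n}. if j \<in> insert z A then {j} else if j \<in> S then {z} else insert z A)
      = (card A + 1) ^ card C" by simp
  moreover have "card (\<Pi>\<^sub>E j\<in>{1..n}. if j \<in> S then {j} else if j \<in> A then {z} else S)
      = (\<Prod>j\<in>C. card (if j \<in> S then {j} else if j \<in> A then {z} else S))"
    by (subst card_PiE, simp, rule prodC) auto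
  moreover have "\<dots> = (\<Prod>j\<in>C. card S)"
    by (rule prod.cong) (auto simp: C_def)
  ultimately show ?thesis
    by (simp add: solution_block_def card_cartesian_product cardC)
qed

text \<open>Subsets are grouped by size. This turns the sums over \<open>S\<close> and
  \<open>A\<close> into sums over \<open>s\<close> and \<open>r\<close>.\<close>

lemma sum_Pow_card:
  fixes f :: "nat \<Rightarrow> 'a::comm_semiring_1"
  assumes "finite B"
  shows "(\<Sum>T\<in>Pow B. f (card T)) = (\<Sum>k\<le>card B. of_nat (card B choose k) * f k)"
proof -
  have "(\<Sum>T\<in>Pow B. f (card T)) = (\<Sum>k\<le>card B. \<Sum>T\<in>{T \<in> Pow B. card T = k}. f (card T))"
    using assms by (intro sum.group[symmetric]) (auto intro: card_mono)
  also have "\<dots> = (\<Sum>k\<le>card B. of_nat (card B choose k) * f k)"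
    using n_subsets[OF assms] by (intro sum.cong) auto
  finally show ?thesis .
qed

lemma card_connected_solutions:
  "card (connected_solutions n) =
    (\<Sum>s\<le>n. \<Sum>r\<le>n - s. (n choose s) * ((n - s) choose r) *
       ((r + 1) ^ (n - s - r) * s ^ (n - s - r + 1)))"
proof -
  let ?f = "\<lambda>s r. (r + 1) ^ (n - s - r) * s ^ (n - s - r + 1)"
  have fin: "finite (block_index n)"
    unfolding block_index_def
    by (intro finite_SigmaI finite_cartesian_product) (auto intro: finite_subset)
  have "connected_solutions n \<subseteq> ({1..n} \<rightarrow>\<^sub>E {1..n}) \<times> ({1..n} \<rightarrow>\<^sub>E {1..n})"
    by (auto simp: connected_solutions_def full_transf_def)
  then have "finite (connected_solutions n)"
    by (rule finite_subset) (intro finite_cartesian_product finite_PiE finite_atLeastAtMost)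
  then have finb: "finite (solution_block n i)" if "i \<in> block_index n" for i
    using that unfolding connected_solutions_eq_UN_blocks by (blast intro: finite_subset)
  have "card (connected_solutions n) = (\<Sum>i\<in>block_index n. card (solution_block n i))"
    unfolding connected_solutions_eq_UN_blocks
    using fin finb solution_blocks_disjoint by (intro card_UN_disjoint) auto
  also have "\<dots> = (\<Sum>(S, A, z)\<in>block_index n.
      (card A + 1) ^ (n - card S - card A) * card S ^ (n - card S - card A))"
    by (rule sum.cong) (auto simp: card_solution_block)
  also have "\<dots> = (\<Sum>S\<in>Pow {1..n}. \<Sum>A\<in>Pow ({1..n} - S). \<Sum>z\<in>S.
      (card A + 1) ^ (n - card S - card A) * card S ^ (n - card S - card A))"
    unfolding block_index_def
    by (subst sum.Sigma[symmetric])
      (auto intro: finite_subset intro!: sum.cong simp del: sum_constant simp: sum.cartesian_product)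
  \<comment> \<open>The summand does not depend on \<open>z\<close>, so summing over
    \<open>z\<close> in \<open>S\<close> raises the exponent of \<open>card S\<close> by
    one.\<close>
  also have "\<dots> = (\<Sum>S\<in>Pow {1..n}. \<Sum>A\<in>Pow ({1..n} - S). ?f (card S) (card A))"
    by (simp add: algebra_simps)
  also have "\<dots> = (\<Sum>S\<in>Pow {1..n}. \<Sum>r\<le>n - card S. ((n - card S) choose r) * ?f (card S) r)"
  proof (rule sum.cong)
    fix S :: "nat set" assume "S \<in> Pow {1..n}"
    then have "card ({1..n} - S) = n - card S"
      by (subst card_Diff_subset) (auto intro: finite_subset)
    then show "(\<Sum>A\<in>Pow ({1..n} - S). ?f (card S) (card A)) =
        (\<Sum>r\<le>n - card S. ((n - card S) choose r) * ?f (card S) r)"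
      using sum_Pow_card[of "{1..n} - S" "?f (card S)"] by simp
  qed simp
  also have "\<dots> = (\<Sum>s\<le>n. (n choose s) * (\<Sum>r\<le>n - s. ((n - s) choose r) * ?f s r))"
    using sum_Pow_card[of "{1..n}" "\<lambda>s. \<Sum>r\<le>n - s. ((n - s) choose r) * ?f s r"] by simp
  also have "\<dots> = (\<Sum>s\<le>n. \<Sum>r\<le>n - s. (n choose s) * ((n - s) choose r) * ?f s r)"
    by (simp add: sum_distrib_left mult.assoc)
  finally show ?thesis .
qed

section \<open>From the double sum to the multinomial formula\<close>

theorem theorem7:
  fixes n :: nat
  assumes "n \<ge> 1"
  shows "real (card (connected_solutions n)) =
    (\<Sum>(r, s, t) \<in> {(r, s, t). r \<le> n \<and> s \<le> n \<and> t \<le> n \<and> r + s + t \<le> n}.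
       fact n / (fact r * fact s * fact t * fact (n - r - s - t))
         * real r ^ (n - r - s - t) * real s ^ (n - r - s + 1))"
proof -
  let ?g = "\<lambda>r s t. fact n / (fact r * fact s * fact t * fact (n - r - s - t))
         * real r ^ (n - r - s - t) * real s ^ (n - r - s + 1)"
  have expand: "real ((n choose s) * ((n - s) choose r) *
       ((r + 1) ^ (n - s - r) * s ^ (n - s - r + 1))) = (\<Sum>t\<le>n - s - r. ?g r s t)"
    if "s \<le> n" "r \<le> n - s" for s r
  proof -
    \<comment> \<open>Here \<open>t\<close> is the exponent of 1, so it counts the remaining points
      that \<open>X\<close> sends to \<open>z\<close>. For \<open>r = 0\<close> only the top term
      survives, by \<open>0 ^ 0 = 1\<close>.\<close>
    have "real ((r + 1) ^ (n - s - r)) =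
        (\<Sum>t\<le>n - s - r. real ((n - s - r) choose t) * real r ^ (n - s - r - t))"
      using binomial_ring[of 1 "real r" "n - s - r"] by (simp add: add.commute)
    then have "real ((n choose s) * ((n - s) choose r) *
       ((r + 1) ^ (n - s - r) * s ^ (n - s - r + 1))) =
       (\<Sum>t\<le>n - s - r. real (n choose s) * real ((n - s) choose r) *
         (real ((n - s - r) choose t) * real r ^ (n - s - r - t) * real s ^ (n - s - r + 1)))"
      by (simp only: of_nat_mult of_nat_power sum_distrib_left sum_distrib_right)
    also have "\<dots> = (\<Sum>t\<le>n - s - r. ?g r s t)"
    proof (rule sum.cong)
      fix t assume "t \<in> {..n - s - r}"
      then have t: "t \<le> n - s - r" by simp
      have d: "n - r - s = n - s - r" by simp
      \<comment> \<open>The intermediate factorials of \<open>n - s\<close> and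
        \<open>n - s - r\<close> cancel, leaving a multinomial coefficient.\<close>
      have "real (n choose s) * real ((n - s) choose r) * real ((n - s - r) choose t) =
          fact n / (fact r * fact s * fact t * fact (n - s - r - t))"
        unfolding binomial_fact[OF that(1)] binomial_fact[OF that(2)] binomial_fact[OF t] by simp
      then show "real (n choose s) * real ((n - s) choose r) *
         (real ((n - s - r) choose t) * real r ^ (n - s - r - t) * real s ^ (n - s - r + 1))
         = ?g r s t"
        unfolding d by (simp only: mult.assoc[symmetric])
    qed simp
    finally show ?thesis .
  qed
  have "real (card (connected_solutions n)) = (\<Sum>s\<le>n. \<Sum>r\<le>n - s. \<Sum>t\<le>n - s - r. ?g r s t)"
    unfolding card_connected_solutions of_nat_sum
    by (intro sum.cong refl expand) auto
  also have "\<dots> = (\<Sum>(s, r, t)\<in>(SIGMA s:{..n}. SIGMA r:{..n - s}. {..n - s - r}). ?g r s t)"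
    by (simp add: sum.Sigma)
  \<comment> \<open>The nested ranges describe exactly the triples with
    \<open>r + s + t \<le> n\<close>; the bijection only swaps the order of \<open>r\<close> and
    \<open>s\<close>.\<close>
  also have "\<dots> = (\<Sum>(r, s, t) \<in> {(r, s, t). r \<le> n \<and> s \<le> n \<and> t \<le> n \<and> r + s + t \<le> n}. ?g r s t)"
    by (rule sum.reindex_bij_witness[where i = "\<lambda>(r, s, t). (s, r, t)" and j = "\<lambda>(s, r, t). (r, s, t)"])
      auto
  finally show ?thesis .
qed

end
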